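(* Let $(a_n)$ be an arithmetic sequence and let $(e_n)$ be an arithmetic-type sequence corresponding to $(a_n)$. If there exists a $b$-divergent set $D\subseteq\mathbb{N}$ such that $d(L(D))=0$, then $|t^{s}_{(e_n)}(\mathbb{T})|=\mathfrak{c}$.
   Context: $\mathbb{N}=\{1,2,3,\dots\}$, $\mathbb{T}=\mathbb{R}/\mathbb{Z}$, $\mathfrak{c}$ is the cardinality of the continuum, $[m,n]$ denotes the set of integers $j$ with $m\le j\le n$, and $\|x\|$ denotes the distance from a real $x$ to the nearest integer (well defined on $\mathbb{T}$). For $A\subseteq\mathbb{N}$, $\overline{d}(A)=\limsup_{n\to\infty}|A\cap[0,n-1]|/n$, $\underline{d}(A)=\liminf_{n\to\infty}|A\cap[0,n-1]|/n$, and $d(A)$ denotes the common value when they agree (natural density). An arithmetic sequence is a sequence of positive integers $1=a_0<a_1<a_2<\cdots$ with $a_n\mid a_{n+1}$ for every $n$; its ratios are $b_n=a_n/a_{n-1}$ for $n\ge 1$. Let $(d_n)$ be the increasing enumeration of the set $\{r a_k : k\ge 0,\ 1\le r<b_{k+1}\}$. An arithmetic-type sequence corresponding to $(a_n)$ is a strictly increasing sequence of integers $(e_n)_{n\in\mathbb{N}}$ such that $(a_n)$ is a subsequence of $(e_n)$ and $(e_n)$ is a subsequence of $(d_n)$. For $k\ge 0$, $n_k$ denotes the index with $e_{n_k}=a_k$ (so $n_0=1$). The lifting function $L:\mathcal{P}(\mathbb{N})\to\mathcal{P}(\mathbb{N})$ is $L(A)=\bigcup_{k\in A}[n_{k-1},n_k-1]$.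 A set $A\subseteq\mathbb{N}$ is $b$-divergent if it is infinite and the sequence of ratios $(b_n)_{n\in A}$ diverges to $\infty$. The statistically characterized subgroup is $t^s_{(e_n)}(\mathbb{T})=\{x\in\mathbb{T}: e_nx\to 0 \text{ statistically}\}$, i.e. the set of $x\in\mathbb{T}$ such that $d(\{n\in\mathbb{N}:\|e_nx\|\ge\varepsilon\})=0$ for every $\varepsilon>0$. *)

theory Defs
  imports "HOL-Analysis.Analysis"
begin

text \<open>Sequences written with indices in the positive integers are functions on \<^typ>\<open>nat\<close> that
  keep their indices; the value at \<open>0\<close> is irrelevant.\<close>

section \<open>Natural density\<close>

definition upper_density :: "nat set \<Rightarrow> ereal" where
  "upper_density A = limsup (\<lambda>n. ereal (real (card (A \<inter> {0..<n})) / real n))"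

definition lower_density :: "nat set \<Rightarrow> ereal" where
  "lower_density A = liminf (\<lambda>n. ereal (real (card (A \<inter> {0..<n})) / real n))"

definition has_natural_density :: "nat set \<Rightarrow> real \<Rightarrow> bool" where
  "has_natural_density A c \<longleftrightarrow> lower_density A = ereal c \<and> upper_density A = ereal c"

section \<open>The circle group\<close>

quotient_type circle = real / "\<lambda>x y :: real. x - y \<in> \<int>"
proof (rule equivpI)
  show "reflp (\<lambda>x y :: real. x - y \<in> \<int>)"
    by (simp add: reflp_def)
  show "symp (\<lambda>x y :: real. x - y \<in> \<int>)"
    by (auto intro!: sympI dest: Ints_minus)
  show "transp (\<lambda>x y :: real. x - y \<in> \<int>)"
    by (rule transpI) (drule (1) Ints_add, simp)
qed

instantiation circle :: ab_group_add
begin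

lift_definition zero_circle :: circle is 0 .

lift_definition plus_circle :: "circle \<Rightarrow> circle \<Rightarrow> circle" is "(+)"
  by (drule (1) Ints_add) (simp add: algebra_simps)

lift_definition uminus_circle :: "circle \<Rightarrow> circle" is uminus
  by (drule Ints_minus) simp

lift_definition minus_circle :: "circle \<Rightarrow> circle \<Rightarrow> circle" is "(-)"
  by (drule (1) Ints_diff) (simp add: algebra_simps)

instance
  by standard (transfer; simp)+

end

lift_definition circle_mult :: "nat \<Rightarrow> circle \<Rightarrow> circle" is "\<lambda>n x. real n * x"
  by (simp flip: right_diff_distrib)

lemma circle_mult_0 [simp]: "circle_mult 0 x = 0"
  by transfer simp

lemma circle_mult_Suc: "circle_mult (Suc n) x = x + circle_mult n x"
  by transfer (simp add: algebra_simps)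

lift_definition circle_norm :: "circle \<Rightarrow> real" is "\<lambda>x. \<bar>x - of_int (round x)\<bar>"
proof -
  fix x y :: real
  assume "x - y \<in> \<int>"
  then obtain k where "x - y = of_int k"
    by (rule Ints_cases)
  then have "x = y + of_int k"
    by simp
  moreover from this have "round x = round y + k"
    unfolding round_def by linarith
  ultimately show "\<bar>x - of_int (round x)\<bar> = \<bar>y - of_int (round y)\<bar>"
    by simp
qed

section \<open>Arithmetic sequences and arithmetic-type sequences\<close>

definition arithmetic_sequence :: "(nat \<Rightarrow> nat) \<Rightarrow> bool" where
  "arithmetic_sequence a \<longleftrightarrow> a 0 = 1 \<and> strict_mono a \<and> (\<forall>n. a n dvd a (Suc n))"

text \<open>For an arithmetic sequence the division is exact.\<close>

definition ratio :: "(nat \<Rightarrow> nat) \<Rightarrow> nat \<Rightarrow> nat" where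
  "ratio a n = a n div a (n - 1)"

definition d_seq :: "(nat \<Rightarrow> nat) \<Rightarrow> nat \<Rightarrow> nat" where
  "d_seq a n = enumerate {r * a k | r k. 1 \<le> r \<and> r < ratio a (k + 1)} (n - 1)"

definition arithmetic_type_sequence :: "(nat \<Rightarrow> nat) \<Rightarrow> (nat \<Rightarrow> nat) \<Rightarrow> bool" where
  "arithmetic_type_sequence a e \<longleftrightarrow>
     strict_mono_on {1..} e \<and>
     (\<exists>m. strict_mono m \<and> range m \<subseteq> {1..} \<and> (\<forall>k. a k = e (m k))) \<and>
     (\<exists>s. strict_mono_on {1..} s \<and> s ` {1..} \<subseteq> {1..} \<and> (\<forall>n\<ge>1. e n = d_seq a (s n)))"

definition lift_index :: "(nat \<Rightarrow> nat) \<Rightarrow> (nat \<Rightarrow> nat) \<Rightarrow> nat \<Rightarrow> nat" where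
  "lift_index a e k = (THE n. 1 \<le> n \<and> e n = a k)"

definition lifting :: "(nat \<Rightarrow> nat) \<Rightarrow> (nat \<Rightarrow> nat) \<Rightarrow> nat set \<Rightarrow> nat set" where
  "lifting a e A = (\<Union>k\<in>A. {lift_index a e (k - 1)..lift_index a e k - 1})"

definition b_divergent :: "(nat \<Rightarrow> nat) \<Rightarrow> nat set \<Rightarrow> bool" where
  "b_divergent a A \<longleftrightarrow>
     infinite A \<and> filterlim (\<lambda>i. ratio a (enumerate A i)) at_top sequentially"

section \<open>Statistically characterized subgroups\<close>

definition stat_char_subgroup :: "(nat \<Rightarrow> nat) \<Rightarrow> circle set" where
  "stat_char_subgroup e =
     {x. \<forall>\<epsilon>>0. has_natural_density {n. 1 \<le> n \<and> circle_norm (circle_mult (e n) x) \<ge> \<epsilon>} 0}"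

end

theory Submission
  imports Defs
begin

text \<open>Points of the form \<open>x = \<Sum>i\<in>S. 1 / a i\<close> with \<open>S \<subseteq> D\<close> lie in the subgroup: if \<open>e n\<close> lies in
  \<open>[a k, a (k+1))\<close>, it is a multiple of \<open>a k\<close>, so modulo 1 only the terms with \<open>i > k\<close>
  contribute to \<open>e n * x\<close>. When \<open>k + 1 \<in> D\<close>, the index \<open>n\<close> lies in the null set \<open>L(D)\<close>; otherwise
  only terms with \<open>i > k + 1\<close> remain, and their contribution is at most \<open>2 / b i\<close> for the first such
  \<open>i \<in> S\<close>. If moreover all ratios along \<open>S\<close> are at least 3, then \<open>x\<close> determines \<open>S\<close>.\<close>

section \<open>Density\<close>

lemma has_natural_density_iff_tendsto:
  "has_natural_density A c \<longleftrightarrow> (\<lambda>n. real (card (A \<inter> {0..<n})) / real n) \<longlonglongrightarrow> c"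
proof -
  have "has_natural_density A c \<longleftrightarrow>
      (\<lambda>n. ereal (real (card (A \<inter> {0..<n})) / real n)) \<longlonglongrightarrow> ereal c"
    unfolding has_natural_density_def lower_density_def upper_density_def
    by (rule tendsto_iff_Liminf_eq_Limsup[symmetric]) simp
  then show ?thesis
    by simp
qed

text \<open>A finite set adds at most \<open>card F / n\<close> to the counting ratio, which tends
  to 0. This lets the membership proof ignore finitely many indices at which the ratios are still
  small.\<close>

lemma has_natural_density_0_subset_Un_finite:
  assumes "has_natural_density B 0" and "A \<subseteq> B \<union> F" and "finite F"
  shows "has_natural_density A 0"
proof -
  have B: "(\<lambda>n. real (card (B \<inter> {0..<n})) / real n) \<longlonglongrightarrow> 0"
    using assms(1) by (simp add: has_natural_density_iff_tendsto)
  have "(\<lambda>n. real (card F) / real n) \<longlonglongrightarrow> 0"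
    by (rule lim_const_over_n)
  from tendsto_add[OF B this]
  have lim: "(\<lambda>n. real (card (B \<inter> {0..<n})) / real n + real (card F) / real n) \<longlonglongrightarrow> 0"
    by simp
  have le: "real (card (A \<inter> {0..<n})) / real n
      \<le> real (card (B \<inter> {0..<n})) / real n + real (card F) / real n" for n
  proof -
    have "card (A \<inter> {0..<n}) \<le> card ((B \<inter> {0..<n}) \<union> F)"
      using assms(2,3) by (intro card_mono) auto
    also have "\<dots> \<le> card (B \<inter> {0..<n}) + card F"
      by (rule card_Un_le)
    finally have "real (card (A \<inter> {0..<n})) \<le> real (card (B \<inter> {0..<n})) + real (card F)"
      by linarith
    then show ?thesis
      by (simp add: divide_right_mono flip: add_divide_distrib)
  qed
  show ?thesis
    unfolding has_natural_density_iff_tendsto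
    by (rule tendsto_sandwich[OF _ _ tendsto_const lim]) (auto simp: le)
qed

section \<open>Arithmetic sequences\<close>

lemma arithmetic_sequence_dvd:
  assumes "arithmetic_sequence a" and "i \<le> j"
  shows "a i dvd a j"
  using assms(2)
proof (induction j rule: dec_induct)
  case base
  then show ?case by simp
next
  case (step n)
  then show ?case
    using assms(1) unfolding arithmetic_sequence_def by (meson dvd_trans)
qed

lemma arithmetic_sequence_mono:
  assumes "arithmetic_sequence a" and "i \<le> j"
  shows "a i \<le> a j"
  using assms by (simp add: arithmetic_sequence_def strict_mono_less_eq)

lemma arithmetic_sequence_pos:
  assumes "arithmetic_sequence a"
  shows "a i > 0"
  using arithmetic_sequence_mono[OF assms, of 0 i] assms by (simp add: arithmetic_sequence_def)

lemma arithmetic_sequence_Suc: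
  assumes "arithmetic_sequence a"
  shows "a (Suc k) = ratio a (Suc k) * a k"
  using assms by (simp add: arithmetic_sequence_def ratio_def)

lemma ratio_Suc_ge_2:
  assumes "arithmetic_sequence a"
  shows "ratio a (Suc k) \<ge> 2"
proof (rule ccontr)
  assume "\<not> ?thesis"
  then have "ratio a (Suc k) \<le> 1" by simp
  then have "a (Suc k) \<le> a k"
    by (simp add: arithmetic_sequence_Suc[OF assms])
  moreover have "a k < a (Suc k)"
    using assms by (simp add: arithmetic_sequence_def strict_mono_less)
  ultimately show False by simp
qed

lemma arithmetic_sequence_add_ge:
  assumes "arithmetic_sequence a"
  shows "2 ^ j * a i \<le> a (i + j)"
proof (induction j)
  case (Suc j)
  have "2 ^ Suc j * a i \<le> 2 * a (i + j)"
    using Suc by simp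
  also have "\<dots> \<le> ratio a (Suc (i + j)) * a (i + j)"
    by (rule mult_right_mono[OF ratio_Suc_ge_2[OF assms]]) simp
  also have "\<dots> = a (i + Suc j)"
    by (simp add: arithmetic_sequence_Suc[OF assms, of "i + j"])
  finally show ?case .
qed simp

section \<open>Sums of reciprocals\<close>

text \<open>The indicator keeps the summation index running over all naturals, so one summability
  proof serves every \<open>S\<close>, finite or infinite, and initial segments can be split
  off.\<close>

definition recip_sum :: "(nat \<Rightarrow> nat) \<Rightarrow> nat set \<Rightarrow> real" where
  "recip_sum a S = (\<Sum>i. indicator S i / real (a i))"

context
  fixes a :: "nat \<Rightarrow> nat"
  assumes a: "arithmetic_sequence a"
begin

text \<open>Every ratio is at least 2. The geometric majorant is anchored at an arbitrary
  \<open>i\<close>: \<open>i = 0\<close> gives summability, the least element of \<open>S\<close>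
  gives the tail estimate.\<close>

lemma recip_term_bound: "indicator S (j + i) / real (a (j + i)) \<le> (1/2) ^ j * (1 / real (a i))"
proof -
  have pos: "real (a i) > 0"
    using arithmetic_sequence_pos[OF a, of i] by simp
  have "2 ^ j * a i \<le> a (j + i)"
    using arithmetic_sequence_add_ge[OF a, of j i] by (simp add: add.commute)
  then have ge: "2 ^ j * real (a i) \<le> real (a (j + i))"
    by (metis of_nat_le_iff of_nat_mult of_nat_numeral of_nat_power)
  have "indicator S (j + i) / real (a (j + i)) \<le> 1 / real (a (j + i))"
    by (intro divide_right_mono) (auto simp: indicator_def)
  also have "\<dots> \<le> 1 / (2 ^ j * real (a i))"
    using ge pos arithmetic_sequence_pos[OF a] by (intro divide_left_mono mult_pos_pos) auto
  finally show ?thesis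
    by (simp add: power_one_over)
qed

lemma recip_summable: "summable (\<lambda>i. indicator S i / real (a i))"
proof (rule summable_comparison_test')
  show "summable (\<lambda>j. (1/2) ^ j * (1 / real (a 0)))"
    by (intro summable_mult2 summable_geometric) simp
  show "norm (indicator S n / real (a n)) \<le> (1/2) ^ n * (1 / real (a 0))" for n
    using recip_term_bound[of S n 0] by simp
qed

lemma recip_sum_nonneg: "recip_sum a S \<ge> 0"
  unfolding recip_sum_def by (intro suminf_nonneg recip_summable) auto

lemma recip_sum_Un:
  assumes "S \<inter> T = {}"
  shows "recip_sum a (S \<union> T) = recip_sum a S + recip_sum a T"
proof -
  have "indicator (S \<union> T) i / real (a i) = indicator S i / real (a i) + indicator T i / real (a i)" for i
    using assms by (auto simp: indicator_def)
  then show ?thesis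
    unfolding recip_sum_def by (simp add: suminf_add[OF recip_summable recip_summable])
qed

lemma recip_sum_finite:
  assumes "finite S"
  shows "recip_sum a S = (\<Sum>i\<in>S. 1 / real (a i))"
proof -
  have "recip_sum a S = (\<Sum>i\<in>S. indicator S i / real (a i))"
    unfolding recip_sum_def by (rule suminf_finite[OF assms]) simp
  then show ?thesis
    by simp
qed

text \<open>The ratio at the least element \<open>i\<close> of \<open>S\<close> gives
  \<open>a i \<ge> q * a k\<close>; the geometric majorant from \<open>i\<close> onwards then costs
  only a factor 2.\<close>

lemma recip_sum_le:
  assumes "S \<subseteq> {k<..}" and "\<And>i. i \<in> S \<Longrightarrow> q \<le> ratio a i" and "q > 0"
  shows "recip_sum a S \<le> 2 / (real q * real (a k))"
proof (cases "S = {}")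
  case True
  then show ?thesis
    by (simp add: recip_sum_def)
next
  case False
  define i where "i = (LEAST i. i \<in> S)"
  have i: "i \<in> S"
    using False unfolding i_def by (metis LeastI ex_in_conv)
  have least: "i \<le> j" if "j \<in> S" for j
    using that unfolding i_def by (rule Least_le)
  from i assms(1) obtain l where l: "i = Suc l" "k \<le> l"
    by (cases i) auto
  have "q * a k \<le> ratio a i * a l"
    using assms(2)[OF i] arithmetic_sequence_mono[OF a l(2)] by (rule mult_le_mono)
  also have "\<dots> = a i"
    using arithmetic_sequence_Suc[OF a, of l] l by simp
  finally have qa: "real q * real (a k) \<le> real (a i)"
    by (metis of_nat_le_iff of_nat_mult)
  have pos: "real q * real (a k) > 0"
    using assms(3) arithmetic_sequence_pos[OF a, of k] by simp
  have "recip_sum a S = (\<Sum>j. indicator S (j + i) / real (a (j + i)))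
      + (\<Sum>j<i. indicator S j / real (a j))"
    unfolding recip_sum_def by (rule suminf_split_initial_segment[OF recip_summable])
  also have "(\<Sum>j<i. indicator S j / real (a j)) = 0"
    using least by (intro sum.neutral) (auto simp: indicator_def dest: leD)
  also have "(\<Sum>j. indicator S (j + i) / real (a (j + i))) \<le> (\<Sum>j. (1/2) ^ j * (1 / real (a i)))"
    using recip_term_bound summable_ignore_initial_segment[OF recip_summable]
    by (intro suminf_le summable_mult2 summable_geometric) auto
  also have "\<dots> = 2 * (1 / real (a i))"
    by (subst suminf_mult2[symmetric]) (simp_all add: summable_geometric suminf_geometric)
  also have "\<dots> \<le> 2 / (real q * real (a k))"
    using divide_left_mono[OF qa, of 2] pos qa by simp
  finally show ?thesis by simp
qed

text \<open>The part of \<open>T\<close> beyond \<open>i\<close> sums to at most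
  \<open>2 / (3 * a i)\<close>, less than the single term \<open>1 / a i\<close> of
  \<open>S\<close>. Ratios of 2 would allow equality, as with ambiguous binary expansions.\<close>

lemma recip_sum_less:
  assumes "\<And>j. j \<in> T \<Longrightarrow> 3 \<le> ratio a j"
    and "i \<in> S" "i \<notin> T" and "S \<inter> {..<i} = T \<inter> {..<i}"
  shows "recip_sum a T < recip_sum a S"
proof -
  have pos: "real (a i) > 0"
    using arithmetic_sequence_pos[OF a, of i] by simp
  have "recip_sum a T = recip_sum a (T \<inter> {..<i}) + recip_sum a (T \<inter> {i<..})"
    using assms(3) by (subst recip_sum_Un[symmetric]) (auto intro!: arg_cong[where f = "recip_sum a"]
        simp: not_less order_le_less)
  also have "recip_sum a (T \<inter> {i<..}) \<le> 2 / (real 3 * real (a i))"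
    using assms(1) by (intro recip_sum_le) auto
  also have "\<dots> < 1 / real (a i)"
    using pos by (simp add: divide_simps)
  also have "\<dots> = recip_sum a {i}"
    by (simp add: recip_sum_finite)
  also have "recip_sum a {i} \<le> recip_sum a {i} + recip_sum a (S \<inter> {i<..})"
    using recip_sum_nonneg by simp
  also have "recip_sum a (T \<inter> {..<i}) + (recip_sum a {i} + recip_sum a (S \<inter> {i<..})) = recip_sum a S"
  proof -
    have S: "S = (S \<inter> {..<i}) \<union> ({i} \<union> (S \<inter> {i<..}))"
      using assms(2) by (auto simp: not_less order_le_less)
    have "recip_sum a S = recip_sum a (S \<inter> {..<i}) + recip_sum a ({i} \<union> (S \<inter> {i<..}))"
      by (subst S, rule recip_sum_Un) auto
    also have "recip_sum a ({i} \<union> (S \<inter> {i<..})) = recip_sum a {i} + recip_sum a (S \<inter> {i<..})"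
      by (rule recip_sum_Un) auto
    finally show ?thesis
      using assms(4) by simp
  qed
  finally show ?thesis by simp
qed

lemma inj_on_recip_sum_circle:
  assumes "D \<subseteq> {0<..}" and "\<And>i. i \<in> D \<Longrightarrow> 3 \<le> ratio a i"
  shows "inj_on (\<lambda>S. abs_circle (recip_sum a S)) (Pow D)"
proof (rule inj_onI, rule ccontr)
  fix S T
  assume ST: "S \<in> Pow D" "T \<in> Pow D" and eq: "abs_circle (recip_sum a S) = abs_circle (recip_sum a T)"
    and "S \<noteq> T"
  \<comment> \<open>The tail bound with \<open>k = 0\<close>, \<open>q = 3\<close> and
    \<open>a 0 = 1\<close>. All sums lie in an interval shorter than 1, so equality modulo 1 is
    equality of reals.\<close>
  have bound: "0 \<le> recip_sum a U \<and> recip_sum a U \<le> 2/3" if "U \<in> Pow D" for U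
    using recip_sum_le[of U 0 3] recip_sum_nonneg[of U] that assms a
    by (auto simp: arithmetic_sequence_def)
  have "recip_sum a S - recip_sum a T \<in> \<int>"
    using eq by (simp add: circle.abs_eq_iff)
  then obtain z where z: "recip_sum a S - recip_sum a T = of_int z"
    by (rule Ints_cases)
  with bound[OF ST(1)] bound[OF ST(2)] have "\<bar>real_of_int z\<bar> < 1"
    by linarith
  then have "z = 0" by linarith
  with z have eq': "recip_sum a S = recip_sum a T" by simp
  \<comment> \<open>The least element of the symmetric difference: whichever set contains it has the
    strictly larger sum.\<close>
  define i where "i = (LEAST i. i \<in> S \<longleftrightarrow> i \<notin> T)"
  have "\<exists>i. i \<in> S \<longleftrightarrow> i \<notin> T"
    using \<open>S \<noteq> T\<close> by blast
  then have i: "i \<in> S \<longleftrightarrow> i \<notin> T"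
    unfolding i_def by (rule LeastI_ex)
  have below: "S \<inter> {..<i} = T \<inter> {..<i}"
    using not_less_Least[of _ "\<lambda>i. i \<in> S \<longleftrightarrow> i \<notin> T"] unfolding i_def by blast
  have ratios: "3 \<le> ratio a j" if "j \<in> S \<or> j \<in> T" for j
    using that ST assms(2) by blast
  show False
  proof (cases "i \<in> S")
    case True
    then show False
      using recip_sum_less[of T i S] ratios i below eq' by auto
  next
    case False
    then show False
      using recip_sum_less[of S i T] ratios i below eq' by auto
  qed
qed

lemma mult_recip_sum_Ints:
  assumes "S \<subseteq> {..k}"
  shows "real (a k) * recip_sum a S \<in> \<int>"
proof -
  have "real (a k) * (1 / real (a i)) \<in> \<int>" if "i \<in> S" for i
  proof -
    have "a i dvd a k"
      using that assms by (intro arithmetic_sequence_dvd[OF a]) auto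
    then obtain c where "a k = a i * c" ..
    then show ?thesis
      using arithmetic_sequence_pos[OF a, of i] by simp
  qed
  then show ?thesis
    using finite_subset[OF assms] by (auto simp: recip_sum_finite sum_distrib_left intro!: Ints_sum)
qed

text \<open>Terms up to \<open>k\<close> become integers and \<open>Suc k\<close> is missing, so the
  rest is at most \<open>2 / (q * a (Suc k))\<close>. The bound \<open>n \<le> a (Suc k)\<close>
  cancels that denominator.\<close>

lemma circle_norm_mult_recip_sum_le:
  assumes "a k dvd n" "n \<le> a (Suc k)" "Suc k \<notin> S"
    and "\<And>i. i \<in> S \<Longrightarrow> i > Suc k \<Longrightarrow> q \<le> ratio a i" and "q > 0"
  shows "circle_norm (circle_mult n (abs_circle (recip_sum a S))) \<le> 2 / real q"
proof -
  obtain r where r: "n = a k * r"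
    using assms(1) ..
  define x where "x = recip_sum a S"
  define y where "y = recip_sum a (S \<inter> {Suc k<..})"
  have S: "S = (S \<inter> {..k}) \<union> (S \<inter> {Suc k<..})"
    using assms(3) by (force simp: not_le less_Suc_eq_le Suc_less_eq intro: Suc_lessI)
  have x: "x = recip_sum a (S \<inter> {..k}) + y"
    unfolding x_def y_def by (subst S, rule recip_sum_Un) auto
  have "real r * (real (a k) * recip_sum a (S \<inter> {..k})) \<in> \<int>"
    by (intro Ints_mult mult_recip_sum_Ints) auto
  then obtain z where "real r * (real (a k) * recip_sum a (S \<inter> {..k})) = of_int z"
    by (rule Ints_cases)
  then have nx: "real n * x = of_int z + real n * y"
    by (simp add: x r algebra_simps)
  have pos: "real (a (Suc k)) > 0"
    using arithmetic_sequence_pos[OF a, of "Suc k"] by simp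
  have y: "0 \<le> y" "y \<le> 2 / (real q * real (a (Suc k)))"
    unfolding y_def using assms(4,5) by (auto intro: recip_sum_nonneg intro!: recip_sum_le)
  have "circle_norm (circle_mult n (abs_circle x)) = \<bar>real n * x - of_int (round (real n * x))\<bar>"
    by (simp add: circle_norm.abs_eq circle_mult.abs_eq)
  \<comment> \<open>Any integer bounds the distance to the nearest one from above, so the rounded
    value need not be identified.\<close>
  also have "\<dots> \<le> \<bar>real n * x - of_int z\<bar>"
    by (rule round_diff_minimal)
  also have "\<dots> = real n * y"
    using nx y by simp
  also have "\<dots> \<le> real (a (Suc k)) * (2 / (real q * real (a (Suc k))))"
    using assms(2) y by (intro mult_mono) auto
  also have "\<dots> = 2 / real q"
    using pos by simp
  finally show ?thesis
    by (simp add: x_def)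
qed

end

section \<open>Arithmetic-type sequences\<close>

lemma d_seq_block:
  assumes "arithmetic_sequence a"
  obtains k where "a k dvd d_seq a n" "a k \<le> d_seq a n" "d_seq a n < a (Suc k)"
proof -
  let ?E = "{r * a k | r k. 1 \<le> r \<and> r < ratio a (k + 1)}"
  \<comment> \<open>Choosing \<open>r = 1\<close> shows that the enumerated set is infinite, which
    guarantees that \<open>enumerate\<close> stays inside it.\<close>
  have "range a \<subseteq> ?E"
  proof
    fix x assume "x \<in> range a"
    then obtain k where "x = 1 * a k" by auto
    moreover have "1 < ratio a (k + 1)"
      using ratio_Suc_ge_2[OF assms, of k] by simp
    ultimately show "x \<in> ?E" by blast
  qed
  moreover have "infinite (range a)"
    using assms by (simp add: arithmetic_sequence_def strict_mono_imp_inj_on finite_image_iff)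
  ultimately have "infinite ?E"
    using finite_subset by blast
  then have "d_seq a n \<in> ?E"
    unfolding d_seq_def by (rule enumerate_in_set)
  then obtain r k where rk: "d_seq a n = r * a k" "1 \<le> r" "r < ratio a (Suc k)"
    by auto
  then have "r * a k < a (Suc k)"
    using arithmetic_sequence_pos[OF assms, of k] by (simp add: arithmetic_sequence_Suc[OF assms])
  with rk show thesis
    by (intro that[of k]) auto
qed

text \<open>Divergence is stated along the positions of the enumeration of \<open>D\<close>. Since
  the enumeration is increasing, a threshold \<open>N\<close> on positions becomes the threshold
  \<open>enumerate D N\<close> on elements.\<close>

lemma b_divergent_eventually:
  assumes "b_divergent a D"
  obtains K where "\<And>i. i \<in> D \<Longrightarrow> K \<le> i \<Longrightarrow> q \<le> ratio a i"
proof -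
  from assms have inf: "infinite D"
    and "eventually (\<lambda>i. q \<le> ratio a (enumerate D i)) sequentially"
    by (simp_all add: b_divergent_def filterlim_at_top)
  then obtain N where N: "\<And>i. i \<ge> N \<Longrightarrow> q \<le> ratio a (enumerate D i)"
    by (auto simp: eventually_sequentially)
  show thesis
  proof (rule that[of "enumerate D N"])
    fix i assume "i \<in> D" "enumerate D N \<le> i"
    moreover obtain j where "i = enumerate D j"
      using enumerate_Ex[OF inf \<open>i \<in> D\<close>] by metis
    ultimately show "q \<le> ratio a i"
      using N[of j] inf by (simp add: enumerate_mono_le_iff)
  qed
qed

lemma recip_sum_mem_stat_char_subgroup:
  assumes a: "arithmetic_sequence a" and e: "arithmetic_type_sequence a e"
    and D: "b_divergent a D" "has_natural_density (lifting a e D) 0" and "S \<subseteq> D"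
  shows "abs_circle (recip_sum a S) \<in> stat_char_subgroup e"
  unfolding stat_char_subgroup_def
proof (intro CollectI allI impI)
  fix \<epsilon> :: real
  assume "\<epsilon> > 0"
  let ?x = "abs_circle (recip_sum a S)"
  from e obtain m s where e_mono: "strict_mono_on {1..} e"
    and m: "strict_mono m" "range m \<subseteq> {1..}" "\<And>k. a k = e (m k)"
    and s: "\<And>n. n \<ge> 1 \<Longrightarrow> e n = d_seq a (s n)"
    unfolding arithmetic_type_sequence_def by blast
  have m1: "m k \<ge> 1" for k
    using m(2) by auto
  have e_less: "e i < e j \<longleftrightarrow> i < j" if "i \<ge> 1" "j \<ge> 1" for i j
    using strict_mono_on_less[OF e_mono] that by simp
  \<comment> \<open>Strict monotonicity of \<open>e\<close> makes the described index unique, so the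
    blocks of the lifting are delimited by the values of \<open>m\<close>.\<close>
  have lift: "lift_index a e k = m k" for k
    unfolding lift_index_def
  proof (rule the_equality)
    show "n = m k" if "1 \<le> n \<and> e n = a k" for n
      using that m1[of k] m(3)[of k] e_less[of n "m k"] e_less[of "m k" n] by auto
  qed (use m m1 in auto)
  \<comment> \<open>Chosen so that the norm bound \<open>2 / q\<close> falls strictly below
    \<epsilon>.\<close>
  obtain q :: nat where "2 / \<epsilon> < real q"
    using reals_Archimedean2 by blast
  moreover from this have "q > 0"
    using \<open>\<epsilon> > 0\<close> by (auto intro!: gr0I simp: field_simps)
  ultimately have q: "q > 0" "2 / real q < \<epsilon>"
    using \<open>\<epsilon> > 0\<close> by (simp_all add: field_simps)
  obtain K where K: "\<And>i. i \<in> D \<Longrightarrow> K \<le> i \<Longrightarrow> q \<le> ratio a i"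
    using b_divergent_eventually[OF D(1)] by blast
  \<comment> \<open>Beyond \<open>m K\<close> the value \<open>e n\<close> is at least
    \<open>a K\<close>, so all remaining terms have ratio at least \<open>q\<close>; a large norm
    then forces \<open>n\<close> into the lifting.\<close>
  have "{n. 1 \<le> n \<and> circle_norm (circle_mult (e n) ?x) \<ge> \<epsilon>} \<subseteq> lifting a e D \<union> {..<m K}"
  proof (rule subsetI, rule ccontr)
    fix n
    assume n: "n \<in> {n. 1 \<le> n \<and> circle_norm (circle_mult (e n) ?x) \<ge> \<epsilon>}"
      and not: "n \<notin> lifting a e D \<union> {..<m K}"
    from n have "n \<ge> 1" by simp
    obtain k where k: "a k dvd e n" "a k \<le> e n" "e n < a (Suc k)"
      using d_seq_block[OF a, of "s n"] s[OF \<open>n \<ge> 1\<close>] by metis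
    have less: "n < m (Suc k)"
      using k(3) m(3) e_less[OF \<open>n \<ge> 1\<close> m1] by simp
    have le: "m k \<le> n"
      using k(2) m(3) e_less[OF \<open>n \<ge> 1\<close> m1] by (simp flip: not_less)
    have "m K < m (Suc k)"
      using not less by simp
    then have "K \<le> k"
      using m(1) by (simp add: strict_mono_less)
    \<comment> \<open>Positions from \<open>m k\<close> to \<open>m (Suc k) - 1\<close> form the
      block of \<open>Suc k\<close>, not of \<open>k\<close>.\<close>
    have "Suc k \<notin> D"
    proof
      assume "Suc k \<in> D"
      then have "n \<in> lifting a e D"
        unfolding lifting_def lift using less le by (auto intro!: bexI[of _ "Suc k"])
      with not show False by simp
    qed
    then have "circle_norm (circle_mult (e n) ?x) \<le> 2 / real q"
      using k q K \<open>S \<subseteq> D\<close> \<open>K \<le> k\<close>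
      by (intro circle_norm_mult_recip_sum_le[OF a k(1)]) (auto simp: subset_iff)
    with n q show False by simp
  qed
  from has_natural_density_0_subset_Un_finite[OF D(2) this]
  show "has_natural_density {n. 1 \<le> n \<and> circle_norm (circle_mult (e n) ?x) \<ge> \<epsilon>} 0"
    by simp
qed

section \<open>Cardinality\<close>

text \<open>Dedekind cuts embed the reals into the sets of rationals, and the countable set of
  rationals embeds into any infinite \<open>D\<close>.\<close>

lemma real_lepoll_Pow_infinite:
  assumes "infinite D"
  shows "(UNIV :: real set) \<lesssim> Pow D"
proof -
  let ?cut = "\<lambda>x::real. {q::rat. of_rat q < x}"
  have "inj ?cut"
  proof (rule linorder_injI)
    fix x y :: real assume "x < y"
    then obtain q where "x < of_rat q" "of_rat q < y"
      using of_rat_dense by blast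
    then show "?cut x \<noteq> ?cut y"
      by (metis mem_Collect_eq not_less_iff_gr_or_eq)
  qed
  then have "(UNIV :: real set) \<lesssim> Pow (UNIV :: rat set)"
    unfolding lepoll_def by auto
  moreover obtain f :: "rat \<Rightarrow> 'a" where f: "inj f" "range f \<subseteq> D"
  proof -
    have "(UNIV :: rat set) \<lesssim> (UNIV :: nat set)"
      unfolding lepoll_def using inj_to_nat by blast
    also have "(UNIV :: nat set) \<lesssim> D"
      using assms by (simp add: infinite_le_lepoll)
    finally show thesis
      using that unfolding lepoll_def by blast
  qed
  then have "Pow (UNIV :: rat set) \<lesssim> Pow D"
    unfolding lepoll_def by (intro exI[of _ "image f"]) (auto simp: inj_on_def inj_image_eq_iff)
  ultimately show ?thesis
    by (rule lepoll_trans)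
qed

text \<open>Choosing representatives is injective because \<open>abs_circle\<close> recovers the
  class.\<close>

lemma circle_lepoll_real: "(A :: circle set) \<lesssim> (UNIV :: real set)"
proof -
  have "inj_on rep_circle A"
    by (rule inj_on_inverseI[of _ abs_circle]) (rule Quotient3_abs_rep[OF Quotient3_circle])
  then show ?thesis
    unfolding lepoll_def by blast
qed

theorem lemma3p8:
  fixes a e :: "nat \<Rightarrow> nat"
  assumes "arithmetic_sequence a"
    and "arithmetic_type_sequence a e"
    and "\<exists>D \<subseteq> {1..}. b_divergent a D \<and> has_natural_density (lifting a e D) 0"
  shows "stat_char_subgroup e \<approx> (UNIV :: real set)"
proof (rule lepoll_antisym[OF circle_lepoll_real])
  obtain D where D: "D \<subseteq> {1..}" "b_divergent a D" "has_natural_density (lifting a e D) 0"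
    using assms(3) by blast
  obtain K where K: "\<And>i. i \<in> D \<Longrightarrow> K \<le> i \<Longrightarrow> 3 \<le> ratio a i"
    using b_divergent_eventually[OF D(2)] by blast
  \<comment> \<open>Dropping finitely many elements makes all ratios at least 3, as injectivity
    requires. The set stays infinite, and its subsets are still subsets of \<open>D\<close>, so
    membership in the subgroup applies.\<close>
  define D' where "D' = D - {..<K}"
  have "infinite D'"
    using D(2) by (simp add: D'_def b_divergent_def)
  then have "(UNIV :: real set) \<lesssim> Pow D'"
    by (rule real_lepoll_Pow_infinite)
  also have "Pow D' \<lesssim> stat_char_subgroup e"
    unfolding lepoll_def
  proof (intro exI conjI)
    show "inj_on (\<lambda>S. abs_circle (recip_sum a S)) (Pow D')"
      using D(1) K by (intro inj_on_recip_sum_circle[OF assms(1)]) (auto simp: D'_def)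
    show "(\<lambda>S. abs_circle (recip_sum a S)) ` Pow D' \<subseteq> stat_char_subgroup e"
      by (auto simp: D'_def intro!: recip_sum_mem_stat_char_subgroup[OF assms(1,2) D(2,3)])
  qed
  finally show "(UNIV :: real set) \<lesssim> stat_char_subgroup e" .
qed

end
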